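(* Let $n\ge p>0$ be integers with $p$ even, and let $\beta\in(0,1]$. For every $\delta\in[0,2\sqrt p]$ there is $\theta\in\mathbb{R}$ such that for all $U\in\mathrm{St}(n,p)$ and all $Q\in\mathrm{O}(p)$, $$d_\beta\big(U,UQG_p(\theta)Q^T\big)=2\sqrt{\beta p}\,\arcsin\left(\frac{\delta}{2\sqrt p}\right)\quad\text{and}\quad \|U-UQG_p(\theta)Q^T\|_{\mathrm F}=\delta .$$ Hence $\widehat m_\beta(\delta)=m_\beta(\delta)$ for all $\delta\in[0,2\sqrt p]$.
   Context: The Stiefel manifold is $\mathrm{St}(n,p)=\{U\in\mathbb{R}^{n\times p} : U^TU=I_p\}$, with tangent space $T_U\mathrm{St}(n,p)=\{\Delta\in\mathbb{R}^{n\times p} : U^T\Delta+\Delta^TU=0\}$; $\mathrm{O}(p)$ is the orthogonal group and $\|\cdot\|_{\mathrm F}$ the Frobenius norm. For $\beta>0$ the $\beta$-metric is $\langle\Delta,\widetilde\Delta\rangle_\beta=\mathrm{Tr}\big(\Delta^T(I_n-(1-\beta)UU^T)\widetilde\Delta\big)$ for $\Delta,\widetilde\Delta\in T_U\mathrm{St}(n,p)$, with norm $\|\Delta\|_\beta=\sqrt{\langle\Delta,\Delta\rangle_\beta}$. The length of a continuously differentiable curve $\gamma:[0,1]\to\mathrm{St}(n,p)$ is $l_\beta(\gamma)=\int_0^1\|\dot\gamma(t)\|_\beta\,dt$, and the geodesic $\beta$-distance is $d_\beta(U,\widetilde U)=\inf\{l_\beta(\gamma) : \gamma(0)=U,\ \gamma(1)=\widetilde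 U\}$, the infimum being over continuously differentiable curves in $\mathrm{St}(n,p)$. When $n=p$ the manifold has two connected components, and distances are considered between points of the same component. For $p$ even and $\theta\in\mathbb{R}$, $G_p(\theta)\in\mathrm{SO}(p)$ is the block diagonal matrix with $p/2$ diagonal blocks all equal to $\begin{bmatrix}\cos\theta&\sin\theta\\-\sin\theta&\cos\theta\end{bmatrix}$. For $\delta\in[0,2\sqrt p]$, $m_\beta(\delta):=\min\{d_\beta(U,\widetilde U) : U,\widetilde U\in\mathrm{St}(n,p),\ \|\widetilde U-U\|_{\mathrm F}=\delta\}$ and $\widehat m_\beta(\delta):=\min\{1,\sqrt\beta\}\,2\sqrt p\,\arcsin\left(\frac{\delta}{2\sqrt p}\right)$. *)

theory Defs
  imports "HOL-Analysis.Analysis"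
begin

text \<open>
  Real n-by-p matrices are elements of \<open>real^'p^'n\<close> with n = \<open>CARD('n)\<close> rows and
  p = \<open>CARD('p)\<close> columns.  Both are positive, since types are nonempty.  The type-class norm on
  \<open>real^'p^'n\<close> is the square root of the sum of the squares of all entries, i.e. the
  Frobenius norm.
\<close>

definition stiefel :: "(real^'p::finite^'n::finite) set" where
  "stiefel = {U. transpose U ** U = mat 1}"

text \<open>
  The \<open>\<beta>\<close>-metric at a point U of the Stiefel manifold.  The formula is written for arbitrary
  matrices; below it is only applied to velocities of curves in the manifold, which are tangent
  vectors.
\<close>

definition beta_inner ::
    "real \<Rightarrow> real^'p::finite^'n::finite \<Rightarrow> real^'p^'n \<Rightarrow> real^'p^'n \<Rightarrow> real" where
  "beta_inner \<beta> U D D' =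
     trace (transpose D ** (mat 1 - (1 - \<beta>) *\<^sub>R (U ** transpose U)) ** D')"

definition beta_norm ::
    "real \<Rightarrow> real^'p::finite^'n::finite \<Rightarrow> real^'p^'n \<Rightarrow> real" where
  "beta_norm \<beta> U D = sqrt (beta_inner \<beta> U D D)"

text \<open>
  Continuously differentiable curves on the closed unit interval, with one-sided derivatives at
  the end points.  (The library's \<open>C1_differentiable_on\<close> uses two-sided ones.)  Only the values
  on \<open>{0..1}\<close> matter.
\<close>

definition C1_curve_in :: "'a::real_normed_vector set \<Rightarrow> (real \<Rightarrow> 'a) \<Rightarrow> bool" where
  "C1_curve_in S \<gamma> \<longleftrightarrow>
     \<gamma> ` {0..1} \<subseteq> S \<and>
     (\<exists>\<gamma>'. (\<forall>t\<in>{0..1}. (\<gamma> has_vector_derivative \<gamma>' t) (at t within {0..1})) \<and>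
           continuous_on {0..1} \<gamma>')"

definition beta_length :: "real \<Rightarrow> (real \<Rightarrow> real^'p::finite^'n::finite) \<Rightarrow> real" where
  "beta_length \<beta> \<gamma> =
     integral {0..1} (\<lambda>t. beta_norm \<beta> (\<gamma> t) (vector_derivative \<gamma> (at t within {0..1})))"

text \<open>
  The infimum is taken in the extended reals, so that the distance is \<open>\<infinity>\<close> when no
  curve joins the two points (different components in the case n = p).
\<close>

definition beta_dist :: "real \<Rightarrow> real^'p::finite^'n::finite \<Rightarrow> real^'p^'n \<Rightarrow> ereal" where
  "beta_dist \<beta> U V =
     Inf {ereal (beta_length \<beta> \<gamma>) | \<gamma>. C1_curve_in stiefel \<gamma> \<and> \<gamma> 0 = U \<and> \<gamma> 1 = V}"

text \<open>
  The block structure of \<open>G\<^sub>p(\<theta>)\<close> needs an enumeration of the index type, given by its linear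
  order (every positive cardinality is realised by such a type, e.g. a numeral type):
  \<open>index_pos i\<close> is the zero-based position of \<open>i\<close>.  Positions 2k and 2k+1 form the k-th
  diagonal block.
\<close>

definition index_pos :: "'p::{finite,linorder} \<Rightarrow> nat" where
  "index_pos i = card {k. k < i}"

definition block_rot :: "real \<Rightarrow> real^'p::{finite,linorder}^'p::{finite,linorder}" where
  "block_rot \<theta> = (\<chi> i j.
     if i = j then cos \<theta>
     else if even (index_pos i) \<and> index_pos j = index_pos i + 1 then sin \<theta>
     else if even (index_pos j) \<and> index_pos i = index_pos j + 1 then - sin \<theta>
     else 0)"

text \<open>
  The distances over which \<open>m\<^sub>\<beta>(\<delta>)\<close> is the minimum.  Only pairs of points in the same connected
  component are considered, which is a restriction only if n = p.
\<close>

definition dists_at ::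
    "'n::finite itself \<Rightarrow> 'p::finite itself \<Rightarrow> real \<Rightarrow> real \<Rightarrow> ereal set" where
  "dists_at _ _ \<beta> \<delta> =
     {beta_dist \<beta> U V | (U :: real^'p^'n) V.
        U \<in> stiefel \<and> V \<in> stiefel \<and> connected_component stiefel U V \<and> norm (V - U) = \<delta>}"

text \<open>
  \<open>Min\<close> is meaningful for finite sets only, so \<open>m_beta\<close> is an infimum; that it is attained has to
  be stated separately, as \<open>m_beta N P \<beta> \<delta> \<in> dists_at N P \<beta> \<delta>\<close>.
\<close>

definition m_beta ::
    "'n::finite itself \<Rightarrow> 'p::finite itself \<Rightarrow> real \<Rightarrow> real \<Rightarrow> ereal" where
  "m_beta N P \<beta> \<delta> = Inf (dists_at N P \<beta> \<delta>)"

definition m_hat :: "nat \<Rightarrow> real \<Rightarrow> real \<Rightarrow> real" where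
  "m_hat p \<beta> \<delta> = min 1 (sqrt \<beta>) * (2 * sqrt (real p) * arcsin (\<delta> / (2 * sqrt (real p))))"

end

theory Submission imports Defs begin

text \<open>
  Lower bound: the Stiefel manifold lies on the Frobenius sphere of radius \<open>sqrt p\<close>, and
  \<open>\<beta> \<le> 1\<close> gives \<open>\<beta>\<close>-norms at least \<open>sqrt \<beta>\<close> times the Frobenius norm, so no curve beats
  \<open>sqrt \<beta>\<close> times the great-circle distance.  Upper bound: \<open>t \<mapsto> U Q G(t) Q\<^sup>T\<close> is a great circle
  \<open>cos t U + sin t U K\<close> with \<open>K\<close> skew-symmetric and orthogonal, and its velocity lies in the
  column space of the curve, where the \<open>\<beta>\<close>-norm is exactly \<open>sqrt \<beta>\<close> times the Frobenius norm.
\<close>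

section \<open>The Frobenius inner product\<close>

lemma trace_transpose_mult: "trace (transpose A ** B) = A \<bullet> B"
  for A B :: "real^'p::finite^'n::finite"
proof -
  have "trace (transpose A ** B) = (\<Sum>i\<in>UNIV. \<Sum>k\<in>UNIV. A $ k $ i * B $ k $ i)"
    by (simp add: trace_def matrix_matrix_mult_def transpose_def)
  also have "\<dots> = (\<Sum>k\<in>UNIV. \<Sum>i\<in>UNIV. A $ k $ i * B $ k $ i)"
    by (rule sum.swap)
  finally show ?thesis by (simp add: inner_vec_def)
qed

text \<open>Both sides are the trace of \<open>transpose A ** B ** C\<close>; this adjoint rule
  moves \<open>U\<close> across inner products below.\<close>

lemma inner_matrix_mult_right: "A \<bullet> (B ** C) = (transpose B ** A) \<bullet> C"
  for A :: "real^'p::finite^'n::finite" and B :: "real^'m::finite^'n"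
  by (simp add: trace_transpose_mult [symmetric] matrix_transpose_mul matrix_mul_assoc)

lemma scaleR_matrix_mult: "(c *\<^sub>R A) ** B = c *\<^sub>R (A ** B)"
  "A ** (c *\<^sub>R B) = c *\<^sub>R (A ** B)"
  for A :: "real^'m::finite^'n::finite" and B :: "real^'p::finite^'m"
  by (simp_all add: matrix_scalar_ac scalar_matrix_assoc)

lemma transpose_plus: "transpose (A + B) = transpose A + transpose B"
  for A B :: "real^'m::finite^'n::finite"
  by (simp add: vec_eq_iff transpose_def)

lemma matrix_add_rdistrib: "(A + B) ** C = A ** C + B ** C"
  and matrix_minus_rdistrib: "(A - B) ** C = A ** C - B ** C"
  and matrix_minus_ldistrib: "D ** (C - E) = D ** C - D ** E"
  and matrix_uminus_left: "(- A) ** C = - (A ** C)"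
  and matrix_uminus_right: "A ** (- C) = - (A ** C)"
  for A B D :: "real^'m::finite^'n::finite" and C E :: "real^'p::finite^'m"
  by (simp_all add: vec_eq_iff matrix_matrix_mult_def algebra_simps sum.distrib sum_subtractf
      sum_negf)

lemma continuous_on_matrix_mult [continuous_intros]:
  fixes f :: "'a::topological_space \<Rightarrow> real^'m::finite^'n::finite"
    and g :: "'a \<Rightarrow> real^'p::finite^'m"
  assumes "continuous_on S f" "continuous_on S g"
  shows "continuous_on S (\<lambda>x. f x ** g x)"
  unfolding matrix_matrix_mult_def by (intro continuous_intros assms)

lemma continuous_on_transpose [continuous_intros]:
  fixes f :: "'a::topological_space \<Rightarrow> real^'m::finite^'n::finite"
  assumes "continuous_on S f"
  shows "continuous_on S (\<lambda>x. transpose (f x))"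
  unfolding transpose_def by (intro continuous_intros assms)

section \<open>The Stiefel manifold and the beta-metric\<close>

lemma stiefel_inner_mult:
  assumes "U \<in> stiefel" shows "(U ** A) \<bullet> (U ** B) = A \<bullet> B"
  using assms by (simp add: inner_matrix_mult_right stiefel_def matrix_mul_assoc)

lemma stiefel_mult:
  assumes "U \<in> stiefel" "V \<in> stiefel"
  shows "U ** V \<in> stiefel"
proof -
  have "transpose (U ** V) ** (U ** V) = transpose V ** (transpose U ** U) ** V"
    by (simp only: matrix_transpose_mul matrix_mul_assoc)
  then show ?thesis using assms by (simp add: stiefel_def)
qed

lemma inner_stiefel_self:
  fixes U :: "real^'p::finite^'n::finite"
  assumes "U \<in> stiefel" shows "U \<bullet> U = real CARD('p)"
  using assms by (simp add: trace_transpose_mult [symmetric] stiefel_def trace_I)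

text \<open>The subtracted term is the part of \<open>D\<close> seen by the column space of
  \<open>U\<close>. In this form the metric is compared with the Frobenius product just by bounding
  that part.\<close>

lemma beta_inner_self:
  "beta_inner \<beta> U D D = D \<bullet> D - (1 - \<beta>) * ((transpose U ** D) \<bullet> (transpose U ** D))"
proof -
  have "beta_inner \<beta> U D D = D \<bullet> ((mat 1 - (1 - \<beta>) *\<^sub>R (U ** transpose U)) ** D)"
    by (simp add: beta_inner_def trace_transpose_mult [symmetric] matrix_mul_assoc)
  also have "\<dots> = D \<bullet> D - (1 - \<beta>) * (D \<bullet> (U ** (transpose U ** D)))"
    by (simp add: matrix_minus_rdistrib scaleR_matrix_mult inner_diff_right matrix_mul_assoc)
  finally show ?thesis by (simp only: inner_matrix_mult_right)
qed

text \<open>Pythagoras: \<open>U ** transpose U\<close> is the orthogonal projection onto the column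
  space of \<open>U\<close>, and the difference of the two sides is the squared norm of the
  residual.\<close>

lemma inner_transpose_stiefel_mult_le:
  fixes U :: "real^'p::finite^'n::finite" and D :: "real^'q::finite^'n"
  assumes "U \<in> stiefel"
  shows "(transpose U ** D) \<bullet> (transpose U ** D) \<le> D \<bullet> D"
proof -
  let ?X = "transpose U ** D"
  have "(D - U ** ?X) \<bullet> (D - U ** ?X) = D \<bullet> D - 2 * (D \<bullet> (U ** ?X)) + ?X \<bullet> ?X"
    using stiefel_inner_mult [OF assms, of ?X ?X]
    by (simp add: inner_diff_left inner_diff_right inner_commute)
  then have "(D - U ** ?X) \<bullet> (D - U ** ?X) = D \<bullet> D - ?X \<bullet> ?X"
    by (simp only: inner_matrix_mult_right)
  then show ?thesis by (metis inner_ge_zero diff_ge_0_iff_ge)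
qed

text \<open>As \<open>1 - \<beta>\<close> is nonnegative, subtracting the full squared norm of
  \<open>D\<close> in place of its projected part only lowers the value, and \<open>\<beta>\<close>
  times that squared norm remains.\<close>

lemma beta_norm_ge:
  assumes "U \<in> stiefel" "\<beta> \<le> 1"
  shows "sqrt \<beta> * norm D \<le> beta_norm \<beta> U D"
proof -
  have "(1 - \<beta>) * ((transpose U ** D) \<bullet> (transpose U ** D)) \<le> (1 - \<beta>) * (D \<bullet> D)"
    using assms by (intro mult_left_mono inner_transpose_stiefel_mult_le) auto
  then have "\<beta> * (D \<bullet> D) \<le> beta_inner \<beta> U D D"
    by (simp add: beta_inner_self algebra_simps)
  then show ?thesis
    by (simp add: beta_norm_def norm_eq_sqrt_inner real_sqrt_mult [symmetric])
qed

text \<open>The columns of the witness are distinct standard basis vectors, selected by an injection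
  of the column indices into the row indices.\<close>

lemma stiefel_nonempty:
  assumes "CARD('p::finite) \<le> CARD('n::finite)"
  shows "(stiefel :: (real^'p^'n) set) \<noteq> {}"
proof -
  obtain f :: "'p \<Rightarrow> 'n" where f: "inj f"
    using card_le_inj [of "UNIV :: 'p set" "UNIV :: 'n set"] assms by auto
  let ?U = "(\<chi> i j. if i = f j then 1 else 0) :: real^'p^'n"
  have "(\<Sum>k\<in>UNIV. ?U $ k $ i * ?U $ k $ j) = (if i = j then 1 else 0)" for i j
  proof -
    have "(\<Sum>k\<in>UNIV. ?U $ k $ i * ?U $ k $ j)
        = (\<Sum>k\<in>UNIV. if k = f i then if f i = f j then 1 else 0 else 0)"
      by (rule sum.cong) auto
    then show ?thesis by (simp add: inj_eq [OF f])
  qed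
  then have "?U \<in> stiefel"
    by (simp add: stiefel_def vec_eq_iff matrix_matrix_mult_def transpose_def mat_def)
  then show ?thesis by blast
qed

section \<open>Curves on a sphere\<close>

lemma arccos_one_minus_double_square:
  assumes "0 \<le> x" "x \<le> 1"
  shows "arccos (1 - 2 * x\<^sup>2) = 2 * arcsin x"
proof -
  have "cos (2 * arcsin x) = 1 - 2 * x\<^sup>2"
    using assms by (simp add: cos_double_sin)
  moreover have "0 \<le> 2 * arcsin x" "2 * arcsin x \<le> pi"
    using assms arcsin_bounded [of x] arcsin_le_arcsin [of 0 x] by auto
  ultimately show ?thesis by (metis arccos_cos)
qed

text \<open>Law of cosines: the left side is the angle at the centre, the right side expresses the
  same angle through the chord.\<close>

lemma arccos_sphere_diff:
  fixes a b :: "'a::real_inner"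
  assumes "norm a = r" "norm b = r" "0 < r"
  shows "arccos (a \<bullet> b / r\<^sup>2) = 2 * arcsin (norm (b - a) / (2 * r))"
proof -
  have "norm (b - a) \<le> 2 * r"
    using norm_triangle_ineq4 [of b a] assms by simp
  then have "arccos (1 - 2 * (norm (b - a) / (2 * r))\<^sup>2) = 2 * arcsin (norm (b - a) / (2 * r))"
    using assms by (intro arccos_one_minus_double_square) auto
  moreover have "(norm (b - a))\<^sup>2 = 2 * r\<^sup>2 - 2 * (a \<bullet> b)"
    using assms dot_square_norm[of a] dot_square_norm[of b]
    by (simp add: power2_norm_eq_inner inner_diff_left inner_diff_right inner_commute)
  then have "a \<bullet> b = r\<^sup>2 - (norm (b - a))\<^sup>2 / 2"
    by linarith
  then have "a \<bullet> b / r\<^sup>2 = 1 - 2 * (norm (b - a) / (2 * r))\<^sup>2"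
    using assms(3) by (simp add: power_divide power_mult_distrib diff_divide_distrib)
  ultimately show ?thesis by simp
qed

text \<open>Only the component \<open>w\<close> of \<open>a\<close> orthogonal to \<open>x\<close>
  meets the tangent vector \<open>v\<close>, and its norm is \<open>r\<close> times the sine of the
  angle between \<open>a\<close> and \<open>x\<close>. Hence that angle changes at rate at most
  \<open>norm v / r\<close>.\<close>

lemma sphere_angle_speed:
  fixes a x v :: "'a::real_inner"
  assumes "norm a = r" "norm x = r" "0 < r" "x \<bullet> v = 0"
  shows "\<bar>a \<bullet> v\<bar> / r\<^sup>2 \<le> sqrt (1 - (a \<bullet> x / r\<^sup>2)\<^sup>2) * (norm v / r)"
proof -
  define w where "w = a - (a \<bullet> x / r\<^sup>2) *\<^sub>R x"
  have "a \<bullet> v = w \<bullet> v"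
    using assms by (simp add: w_def inner_diff_left)
  then have "\<bar>a \<bullet> v\<bar> \<le> norm w * norm v"
    by (simp add: Cauchy_Schwarz_ineq2)
  moreover have "(norm w)\<^sup>2 = r\<^sup>2 * (1 - (a \<bullet> x / r\<^sup>2)\<^sup>2)"
  proof -
    have aa: "a \<bullet> a = r\<^sup>2" "x \<bullet> x = r\<^sup>2"
      using assms by (simp_all add: dot_square_norm)
    then show ?thesis
      using assms(3) unfolding power2_norm_eq_inner w_def
      by (simp add: aa inner_diff_left inner_diff_right inner_commute [of x a] field_simps
          power2_eq_square)
  qed
  then have "norm w = r * sqrt (1 - (a \<bullet> x / r\<^sup>2)\<^sup>2)"
    using assms by (metis norm_ge_zero real_sqrt_abs real_sqrt_mult abs_of_nonneg less_imp_le)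
  ultimately show ?thesis
    using assms by (simp add: field_simps power2_eq_square)
qed

text \<open>Integrating the bound on the angular speed bounds the angle between the end points. The
  majorant \<open>f\<close> lets a rescaled \<beta>-speed be inserted directly.\<close>

lemma sphere_curve_length_ge:
  fixes \<gamma> \<gamma>' :: "real \<Rightarrow> 'a::real_inner" and f :: "real \<Rightarrow> real"
  assumes r: "0 < r"
    and sph: "\<And>t. t \<in> {0..1} \<Longrightarrow> norm (\<gamma> t) = r"
    and der: "\<And>t. t \<in> {0..1} \<Longrightarrow> (\<gamma> has_vector_derivative \<gamma>' t) (at t within {0..1})"
    and f: "f integrable_on {0..1}" "\<And>t. t \<in> {0..1} \<Longrightarrow> norm (\<gamma>' t) \<le> f t"
  shows "2 * r * arcsin (norm (\<gamma> 1 - \<gamma> 0) / (2 * r)) \<le> integral {0..1} f"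
proof -
  \<comment> \<open>The cosine of the angle between the starting point and
    \<open>\<gamma> t\<close>.\<close>
  define c where "c t = \<gamma> 0 \<bullet> \<gamma> t / r\<^sup>2" for t
  have c_le: "\<bar>c t\<bar> \<le> 1" if "t \<in> {0..1}" for t
    using Cauchy_Schwarz_ineq2 [of "\<gamma> 0" "\<gamma> t"] sph[of 0] sph[OF that] r
    by (simp add: c_def power2_eq_square)
  have orth: "\<gamma> t \<bullet> \<gamma>' t = 0" if t: "t \<in> {0..1}" for t
  proof -
    have "((\<lambda>t. \<gamma> t \<bullet> \<gamma> t) has_vector_derivative (\<gamma> t \<bullet> \<gamma>' t + \<gamma>' t \<bullet> \<gamma> t)) (at t within {0..1})"
      by (intro bounded_bilinear.has_vector_derivative [OF bounded_bilinear_inner] der t)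
    moreover have "((\<lambda>t. \<gamma> t \<bullet> \<gamma> t) has_vector_derivative 0) (at t within {0..1})"
      by (rule has_vector_derivative_transform [OF t, where f = "\<lambda>_. r\<^sup>2"])
        (auto simp: sph dot_square_norm)
    ultimately have "\<gamma> t \<bullet> \<gamma>' t + \<gamma>' t \<bullet> \<gamma> t = 0"
      using t by (intro vector_derivative_unique_within) (auto simp: trivial_limit_within islimpt_Icc)
    then show ?thesis by (simp add: inner_commute)
  qed
  \<comment> \<open>Scaling by \<open>s < 1\<close> keeps \<open>arcsin\<close> away from its singularities at \<open>\<plusminus>1\<close>.\<close>
  have bound: "arcsin s - arcsin (s * c 1) \<le> integral {0..1} f / r" if s: "0 < s" "s < 1" for s
  proof -
    define g' where "g' t = s * (\<gamma> 0 \<bullet> \<gamma>' t / r\<^sup>2) / sqrt (1 - (s * c t)\<^sup>2)" for t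
    have sc: "\<bar>s * c t\<bar> < 1" if "t \<in> {0..1}" for t
    proof -
      have "\<bar>s * c t\<bar> \<le> s * 1"
        unfolding abs_mult using s c_le [OF that] by (intro mult_mono) auto
      then show ?thesis using s by simp
    qed
    have "((\<lambda>t. arcsin (s * c t)) has_vector_derivative g' t) (at t within {0..1})"
      if t: "t \<in> {0..1}" for t
    proof -
      have "(c has_vector_derivative \<gamma> 0 \<bullet> \<gamma>' t / r\<^sup>2) (at t within {0..1})"
        unfolding c_def
        by (intro derivative_intros bounded_linear.has_vector_derivative [OF bounded_linear_inner_right] der t
              bounded_linear.has_vector_derivative [OF bounded_linear_divide])
      then have "(c has_real_derivative \<gamma> 0 \<bullet> \<gamma>' t / r\<^sup>2) (at t within {0..1})"
        by (simp add: has_real_derivative_iff_has_vector_derivative)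
      then have "((\<lambda>t. arcsin (s * c t)) has_real_derivative g' t) (at t within {0..1})"
        using sc [OF t]
        by (auto intro!: derivative_eq_intros simp: g'_def field_simps)
      then show ?thesis by (simp add: has_real_derivative_iff_has_vector_derivative)
    qed
    then have int: "(g' has_integral (arcsin (s * c 1) - arcsin (s * c 0))) {0..1}"
      by (intro fundamental_theorem_of_calculus) auto
    have "- g' t \<le> f t / r" if t: "t \<in> {0..1}" for t
    proof -
      let ?q = "sqrt (1 - (s * c t)\<^sup>2)"
      have q: "0 < ?q"
        using sc [OF t] abs_square_less_1 [of "s * c t"] by simp
      have "s * (\<bar>\<gamma> 0 \<bullet> \<gamma>' t\<bar> / r\<^sup>2) \<le> \<bar>\<gamma> 0 \<bullet> \<gamma>' t\<bar> / r\<^sup>2"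
        using s by (intro mult_left_le_one_le) auto
      also have "\<dots> \<le> sqrt (1 - (c t)\<^sup>2) * (norm (\<gamma>' t) / r)"
        unfolding c_def by (rule sphere_angle_speed) (use r sph t orth in auto)
      \<comment> \<open>Shrinking the cosine by \<open>s\<close> can only enlarge the square root,
        so the numerator is controlled by the very denominator \<open>?q\<close> of
        \<open>g'\<close>.\<close>
      also have "\<dots> \<le> ?q * (norm (\<gamma>' t) / r)"
      proof -
        have "s\<^sup>2 * (c t)\<^sup>2 \<le> (c t)\<^sup>2"
          using s by (intro mult_left_le_one_le) (auto simp: power_le_one)
        then show ?thesis
          using r by (intro mult_right_mono) (auto simp: power_mult_distrib)
      qed
      finally have "s * (\<bar>\<gamma> 0 \<bullet> \<gamma>' t\<bar> / r\<^sup>2) / ?q \<le> norm (\<gamma>' t) / r"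
        by (simp only: pos_divide_le_eq [OF q] mult.commute)
      moreover have "- g' t \<le> \<bar>g' t\<bar>" by simp
      moreover have "\<bar>g' t\<bar> = s * (\<bar>\<gamma> 0 \<bullet> \<gamma>' t\<bar> / r\<^sup>2) / ?q"
        using s q by (simp add: g'_def abs_mult abs_divide)
      moreover have "norm (\<gamma>' t) / r \<le> f t / r"
        using f(2) [OF t] r by (simp add: divide_right_mono)
      ultimately show ?thesis by linarith
    qed
    then have "- (arcsin (s * c 1) - arcsin (s * c 0)) \<le> integral {0..1} f / r"
      by (rule has_integral_le [OF has_integral_neg [OF int]
            has_integral_divide [OF integrable_integral [OF f(1)]]])
    moreover have "c 0 = 1"
      using r sph[of 0] by (simp add: c_def dot_square_norm)
    ultimately show ?thesis by simp
  qed
  \<comment> \<open>Let \<open>s\<close> tend to 1 from below: \<open>arcsin\<close> is continuous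
    up to the end points of its domain, so the bound survives. The left side is then
    \<open>arccos (c 1)\<close>.\<close>
  have "arcsin 1 - arcsin (1 * c 1) \<le> integral {0..1} f / r"
  proof (rule tendsto_upperbound)
    have "\<bar>s * c 1\<bar> \<le> 1" if "s \<in> {0..1}" for s
      using that c_le [of 1] by (simp add: abs_mult mult_le_one)
    then have "\<forall>s\<in>{0..1}. - 1 \<le> s * c 1 \<and> s * c 1 \<le> 1"
      by (meson abs_le_D1 abs_le_D2 minus_le_iff)
    then have "continuous_on {0..1} (\<lambda>s. arcsin s - arcsin (s * c 1))"
      by (intro continuous_intros) auto
    then show "((\<lambda>s. arcsin s - arcsin (s * c 1)) \<longlongrightarrow> arcsin 1 - arcsin (1 * c 1)) (at_left 1)"
      by (rule continuous_on_Icc_at_leftD) simp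
    show "\<forall>\<^sub>F s in at_left 1. arcsin s - arcsin (s * c 1) \<le> integral {0..1} f / r"
      using eventually_at_left_real [of 0 "1::real"]
      by (auto elim!: eventually_mono intro: bound)
  qed simp
  then have "arccos (c 1) \<le> integral {0..1} f / r"
    using c_le [of 1] by (simp add: arccos_arcsin_eq abs_le_iff)
  then show ?thesis
    using arccos_sphere_diff [of "\<gamma> 0" r "\<gamma> 1"] sph r
    by (simp add: c_def pos_le_divide_eq mult_ac)
qed

section \<open>Bounds for the distance\<close>

text \<open>Derivatives within the interval are unique, also at its end points, so any given
  velocity may replace \<open>vector_derivative\<close>.\<close>

lemma beta_length_eq:
  assumes "\<And>t. t \<in> {0..1} \<Longrightarrow> (\<gamma> has_vector_derivative \<gamma>' t) (at t within {0..1})"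
  shows "beta_length \<beta> \<gamma> = integral {0..1} (\<lambda>t. beta_norm \<beta> (\<gamma> t) (\<gamma>' t))"
  unfolding beta_length_def
proof (rule integral_cong)
  fix t :: real assume "t \<in> {0..1}"
  then have "vector_derivative \<gamma> (at t within {0..1}) = \<gamma>' t"
    using vector_derivative_within_cbox [of 0 1 t \<gamma> "\<gamma>' t"] assms by simp
  then show "beta_norm \<beta> (\<gamma> t) (vector_derivative \<gamma> (at t within {0..1}))
      = beta_norm \<beta> (\<gamma> t) (\<gamma>' t)" by simp
qed

lemma beta_length_ge:
  fixes \<gamma> :: "real \<Rightarrow> real^'p::finite^'n::finite"
  assumes "C1_curve_in stiefel \<gamma>" "0 < \<beta>" "\<beta> \<le> 1"
  shows "2 * sqrt (\<beta> * real CARD('p)) * arcsin (norm (\<gamma> 1 - \<gamma> 0) / (2 * sqrt (real CARD('p))))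
    \<le> beta_length \<beta> \<gamma>"
proof -
  obtain \<gamma>' where st: "\<And>t. t \<in> {0..1} \<Longrightarrow> \<gamma> t \<in> stiefel"
    and der: "\<And>t. t \<in> {0..1} \<Longrightarrow> (\<gamma> has_vector_derivative \<gamma>' t) (at t within {0..1})"
    and cont: "continuous_on {0..1} \<gamma>'"
    using assms(1) unfolding C1_curve_in_def by blast
  \<comment> \<open>By \<open>beta_norm_ge\<close> this dominates the Frobenius speed, so the sphere
    estimate applies with radius \<open>sqrt (real CARD('p))\<close>.\<close>
  let ?f = "\<lambda>t. beta_norm \<beta> (\<gamma> t) (\<gamma>' t) / sqrt \<beta>"
  have "continuous_on {0..1} \<gamma>"
    using der by (metis continuous_on_eq_continuous_within has_vector_derivative_continuous)
  then have "continuous_on {0..1} (\<lambda>t. beta_norm \<beta> (\<gamma> t) (\<gamma>' t))"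
    unfolding beta_norm_def beta_inner_self by (intro continuous_intros cont)
  then have "continuous_on {0..1} ?f"
    using assms by (intro continuous_intros) auto
  moreover have "norm (\<gamma>' t) \<le> ?f t" if "t \<in> {0..1}" for t
    using beta_norm_ge [OF st [OF that] assms(3), of "\<gamma>' t"] assms(2)
    by (simp add: pos_le_divide_eq mult.commute)
  ultimately have "2 * sqrt (real CARD('p)) * arcsin (norm (\<gamma> 1 - \<gamma> 0) / (2 * sqrt (real CARD('p))))
      \<le> integral {0..1} ?f"
    by (intro sphere_curve_length_ge [of _ _ \<gamma>'] der integrable_continuous_real)
      (auto simp: norm_eq_sqrt_inner inner_stiefel_self st)
  also have "\<dots> = beta_length \<beta> \<gamma> / sqrt \<beta>"
    using beta_length_eq [of \<gamma> \<gamma>' \<beta>] der by simp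
  finally show ?thesis
    using assms(2) by (simp add: real_sqrt_mult pos_le_divide_eq mult_ac)
qed

text \<open>The length bound depends on the end points only, so it passes to the infimum, including
  the value \<infinity> when no curve exists.\<close>

lemma beta_dist_ge:
  fixes U V :: "real^'p::finite^'n::finite"
  assumes "0 < \<beta>" "\<beta> \<le> 1"
  shows "ereal (2 * sqrt (\<beta> * real CARD('p)) * arcsin (norm (V - U) / (2 * sqrt (real CARD('p)))))
    \<le> beta_dist \<beta> U V"
  unfolding beta_dist_def using beta_length_ge [OF _ assms] by (auto intro!: Inf_greatest)

section \<open>Great circles generated by a skew-symmetric orthogonal matrix\<close>

context
  fixes K :: "real^'p::finite^'p"
  assumes orth_K: "transpose K ** K = mat 1" and skew_K: "transpose K = - K"
begin

text \<open>\<open>K\<close> behaves like the imaginary unit, which makes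
  \<open>cos t *\<^sub>R mat 1 + sin t *\<^sub>R K\<close> the exponential of
  \<open>t *\<^sub>R K\<close>.\<close>

lemma skew_orthogonal_square: "K ** K = - mat 1"
  using orth_K unfolding skew_K matrix_uminus_left by (metis minus_minus)

lemma skew_rotation_stiefel: "cos t *\<^sub>R mat 1 + sin t *\<^sub>R K \<in> stiefel"
proof -
  have "transpose (cos t *\<^sub>R mat 1 + sin t *\<^sub>R K) ** (cos t *\<^sub>R mat 1 + sin t *\<^sub>R K)
      = (cos t * cos t) *\<^sub>R mat 1 + (sin t * sin t) *\<^sub>R mat 1"
    by (simp add: transpose_plus transpose_scalar skew_K matrix_add_rdistrib
        matrix_minus_rdistrib matrix_add_ldistrib scaleR_matrix_mult skew_orthogonal_square
        algebra_simps)
  then show ?thesis by (simp add: stiefel_def scaleR_add_left [symmetric])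
qed

text \<open>A skew-symmetric matrix has trace zero, hence is orthogonal to \<open>mat 1\<close>;
  only the cosine contributes, and the half-angle formula finishes.\<close>

lemma norm_skew_rotation_diff:
  "norm (mat 1 - (cos t *\<^sub>R mat 1 + sin t *\<^sub>R K)) = 2 * sqrt (real CARD('p)) * \<bar>sin (t / 2)\<bar>"
proof -
  let ?R = "cos t *\<^sub>R mat 1 + sin t *\<^sub>R K"
  have "mat 1 \<bullet> K = trace K" "K \<bullet> mat 1 = trace (- K)"
    using trace_transpose_mult [of "mat 1" K] trace_transpose_mult [of K "mat 1"]
    by (simp_all add: transpose_mat skew_K)
  then have 0: "mat 1 \<bullet> K = 0"
    by (simp add: inner_commute trace_def sum_negf)
  have 1: "mat 1 \<bullet> (mat 1 :: real^'p^'p) = CARD('p)"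
    by (rule inner_stiefel_self) (simp add: stiefel_def transpose_mat)
  have "(mat 1 - ?R) \<bullet> (mat 1 - ?R) = mat 1 \<bullet> (mat 1 :: real^'p^'p) - 2 * (mat 1 \<bullet> ?R) + ?R \<bullet> ?R"
    by (simp add: inner_diff_left inner_diff_right inner_commute)
  also have "\<dots> = 2 * real CARD('p) * (1 - cos t)"
    unfolding inner_stiefel_self [OF skew_rotation_stiefel]
    by (simp add: inner_add_right 0 1 algebra_simps)
  also have "1 - cos t = 2 * (sin (t / 2))\<^sup>2"
    using cos_double_sin [of "t / 2"] by simp
  finally show ?thesis
    by (simp add: norm_eq_sqrt_inner real_sqrt_mult)
qed

text \<open>Since \<open>K ** K = - mat 1\<close>, differentiating amounts to right multiplication
  by \<open>\<theta> *\<^sub>R K\<close>, so the velocity stays in the column space of the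
  curve.\<close>

lemma great_circle_velocity:
  fixes U :: "real^'p^'n::finite"
  shows "((\<lambda>t. U ** (cos (t * \<theta>) *\<^sub>R mat 1 + sin (t * \<theta>) *\<^sub>R K)) has_vector_derivative
     \<theta> *\<^sub>R (U ** (cos (t * \<theta>) *\<^sub>R mat 1 + sin (t * \<theta>) *\<^sub>R K) ** K)) (at t within S)"
proof -
  have "((\<lambda>t. cos (t * \<theta>) *\<^sub>R U + sin (t * \<theta>) *\<^sub>R (U ** K)) has_vector_derivative
     - (\<theta> * sin (t * \<theta>)) *\<^sub>R U + (\<theta> * cos (t * \<theta>)) *\<^sub>R (U ** K)) (at t within S)"
    by (auto intro!: derivative_eq_intros simp: mult.commute)
  then show ?thesis
    by (simp add: matrix_add_rdistrib matrix_add_ldistrib scaleR_matrix_mult matrix_mul_assoc [symmetric]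
        skew_orthogonal_square matrix_uminus_right algebra_simps mult.commute)
qed

lemma great_circle_C1:
  fixes U :: "real^'p^'n::finite"
  assumes "U \<in> stiefel"
  shows "C1_curve_in stiefel (\<lambda>t. U ** (cos (t * \<theta>) *\<^sub>R mat 1 + sin (t * \<theta>) *\<^sub>R K))"
  unfolding C1_curve_in_def
  by (intro conjI exI [of _ "\<lambda>t. \<theta> *\<^sub>R (U ** (cos (t * \<theta>) *\<^sub>R mat 1 + sin (t * \<theta>) *\<^sub>R K) ** K)"]
      ballI great_circle_velocity continuous_intros)
    (auto intro: stiefel_mult assms skew_rotation_stiefel)

text \<open>The projection \<open>transpose (\<gamma> t)\<close> recovers
  \<open>\<theta> *\<^sub>R K\<close> from the velocity without loss of norm, so the squared
  \<beta>-speed is constantly \<open>\<beta>\<close> times the squared Frobenius speed.\<close>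

lemma great_circle_beta_length:
  fixes U :: "real^'p^'n::finite"
  assumes U: "U \<in> stiefel" and "0 \<le> \<theta>"
  shows "beta_length \<beta> (\<lambda>t. U ** (cos (t * \<theta>) *\<^sub>R mat 1 + sin (t * \<theta>) *\<^sub>R K))
    = \<theta> * sqrt (\<beta> * real CARD('p))"
proof -
  define \<gamma> where "\<gamma> t = U ** (cos (t * \<theta>) *\<^sub>R mat 1 + sin (t * \<theta>) *\<^sub>R K)" for t
  have "beta_norm \<beta> (\<gamma> t) (\<theta> *\<^sub>R (\<gamma> t ** K)) = \<theta> * sqrt (\<beta> * real CARD('p))" for t
  proof -
    have st: "\<gamma> t \<in> stiefel" "K \<in> stiefel"
      using orth_K unfolding \<gamma>_def
      by (simp_all add: U stiefel_mult skew_rotation_stiefel) (simp add: stiefel_def)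
    then have "transpose (\<gamma> t) ** (\<gamma> t ** K) = K"
      by (simp add: matrix_mul_assoc stiefel_def)
    then have "beta_inner \<beta> (\<gamma> t) (\<theta> *\<^sub>R (\<gamma> t ** K)) (\<theta> *\<^sub>R (\<gamma> t ** K))
        = \<theta>\<^sup>2 * (\<beta> * real CARD('p))"
      by (simp add: beta_inner_self scaleR_matrix_mult stiefel_inner_mult [OF st(1)]
          inner_stiefel_self [OF st(2)] power2_eq_square algebra_simps)
    then show ?thesis
      using assms(2) by (simp add: beta_norm_def real_sqrt_mult)
  qed
  then show ?thesis
    using beta_length_eq [OF great_circle_velocity, of \<beta> U \<theta>] by (simp add: \<gamma>_def)
qed

text \<open>The range of \<open>\<theta>\<close> keeps \<open>\<theta> / 2\<close> where
  \<open>arcsin\<close> inverts \<open>sin\<close>, so the general lower bound equals the length of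
  the great circle. The same curve connects the two points.\<close>

lemma great_circle_norm_dist:
  fixes U :: "real^'p^'n::finite"
  assumes U: "U \<in> stiefel" and \<theta>: "0 \<le> \<theta>" "\<theta> \<le> pi" and \<beta>: "0 < \<beta>" "\<beta> \<le> 1"
  defines "V \<equiv> U ** (cos \<theta> *\<^sub>R mat 1 + sin \<theta> *\<^sub>R K)"
  shows "norm (U - V) = 2 * sqrt (real CARD('p)) * sin (\<theta> / 2)"
    and "beta_dist \<beta> U V = ereal (\<theta> * sqrt (\<beta> * real CARD('p)))"
    and "V \<in> stiefel" and "connected_component stiefel U V"
proof -
  define \<gamma> where "\<gamma> t = U ** (cos (t * \<theta>) *\<^sub>R mat 1 + sin (t * \<theta>) *\<^sub>R K)" for t
  have C1: "C1_curve_in stiefel \<gamma>"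
    unfolding \<gamma>_def using U by (rule great_circle_C1)
  have ends: "\<gamma> 0 = U" "\<gamma> 1 = V" by (simp_all add: V_def \<gamma>_def)
  have "norm (U - V) = norm (U ** (mat 1 - (cos \<theta> *\<^sub>R mat 1 + sin \<theta> *\<^sub>R K)))"
    by (simp add: V_def matrix_minus_ldistrib)
  also have "\<dots> = norm (mat 1 - (cos \<theta> *\<^sub>R mat 1 + sin \<theta> *\<^sub>R K))"
    by (simp only: norm_eq_sqrt_inner stiefel_inner_mult [OF U])
  also have "\<dots> = 2 * sqrt (real CARD('p)) * sin (\<theta> / 2)"
    using \<theta> sin_ge_zero [of "\<theta> / 2"] by (simp only: norm_skew_rotation_diff) simp
  finally show norm: "norm (U - V) = 2 * sqrt (real CARD('p)) * sin (\<theta> / 2)" .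
  have "beta_dist \<beta> U V \<le> ereal (\<theta> * sqrt (\<beta> * real CARD('p)))"
    unfolding beta_dist_def great_circle_beta_length [OF U \<theta>(1), symmetric] \<gamma>_def [symmetric]
    by (rule Inf_lower) (use C1 ends in blast)
  moreover have "arcsin (norm (V - U) / (2 * sqrt (real CARD('p)))) = \<theta> / 2"
    using \<theta> by (simp add: norm_minus_commute [of V] norm arcsin_sin)
  then have "ereal (\<theta> * sqrt (\<beta> * real CARD('p))) \<le> beta_dist \<beta> U V"
    using beta_dist_ge [OF \<beta>, of V U] by (simp only:) (simp add: mult_ac)
  ultimately show "beta_dist \<beta> U V = ereal (\<theta> * sqrt (\<beta> * real CARD('p)))"
    by (rule antisym)
  have sub: "\<gamma> ` {0..1} \<subseteq> stiefel" using C1 by (simp add: C1_curve_in_def)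
  have mem: "U \<in> \<gamma> ` {0..1}" "V \<in> \<gamma> ` {0..1}"
    unfolding ends [symmetric] by auto
  then show "V \<in> stiefel" using sub by blast
  have "connected (\<gamma> ` {0..1})"
    unfolding \<gamma>_def by (intro connected_continuous_image continuous_intros) auto
  then show "connected_component stiefel U V"
    using sub mem unfolding connected_component_def by blast
qed

end

section \<open>The block rotation\<close>

lemma index_pos_less: "index_pos i < CARD('p)" for i :: "'p::{finite,linorder}"
  unfolding index_pos_def by (intro psubset_card_mono) auto

lemma index_pos_strict_mono: "i < j \<Longrightarrow> index_pos i < index_pos j"
  for i j :: "'p::{finite,linorder}"
  unfolding index_pos_def by (intro psubset_card_mono) auto

lemma inj_index_pos: "inj (index_pos :: 'p::{finite,linorder} \<Rightarrow> nat)"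
  by (rule injI) (metis index_pos_strict_mono less_irrefl linorder_cases)

lemma range_index_pos: "range (index_pos :: 'p::{finite,linorder} \<Rightarrow> nat) = {..<CARD('p)}"
  by (intro card_subset_eq) (auto simp: index_pos_less card_image inj_index_pos)

text \<open>The quarter turn \<open>block_rot (pi / 2)\<close> is the model for the generator
  \<open>K\<close>.\<close>

lemma block_rot_decompose: "block_rot \<theta> = cos \<theta> *\<^sub>R mat 1 + sin \<theta> *\<^sub>R block_rot (pi / 2)"
  by (auto simp: block_rot_def vec_eq_iff mat_def)

lemma transpose_block_rot_right_angle: "transpose (block_rot (pi / 2)) = - block_rot (pi / 2)"
  by (auto simp: block_rot_def vec_eq_iff transpose_def)

text \<open>The quarter turn is a signed permutation matrix: each row has one nonzero entry, in the
  column of the other index of its block.\<close>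

lemma block_rot_right_angle_orthogonal:
  assumes "even CARD('p::{finite,linorder})"
  shows "transpose (block_rot (pi / 2)) ** block_rot (pi / 2)
    = (mat 1 :: real^'p::{finite,linorder}^'p::{finite,linorder})"
proof -
  let ?J = "block_rot (pi / 2) :: real^'p::{finite,linorder}^'p::{finite,linorder}"
  \<comment> \<open>Swaps positions 2k and 2k+1. The truncated subtraction is harmless, as it is
    applied to odd numbers only.\<close>
  define partner :: "nat \<Rightarrow> nat" where "partner n = (if even n then n + 1 else n - 1)" for n
  have inv: "partner (partner n) = n" for n
    by (simp add: partner_def)
  have "\<exists>k :: 'p. index_pos k = partner (index_pos i)" for i :: 'p
  proof -
    \<comment> \<open>Because the number of columns is even, an even position is never the last
      one.\<close>
    have "partner (index_pos i) < CARD('p)"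
      using index_pos_less [of i] assms by (auto simp: partner_def) presburger
    then show ?thesis using range_index_pos by (metis imageE lessThan_iff)
  qed
  then obtain \<sigma> :: "'p \<Rightarrow> 'p" where \<sigma>: "\<And>i. index_pos (\<sigma> i) = partner (index_pos i)"
    by metis
  have \<sigma>_inj: "\<sigma> i = \<sigma> j \<longleftrightarrow> i = j" for i j
    by (metis \<sigma> inv injD inj_index_pos)
  define \<epsilon> :: "'p \<Rightarrow> real" where "\<epsilon> i = (if even (index_pos i) then 1 else - 1)" for i
  have entry: "?J $ i $ j = (if j = \<sigma> i then \<epsilon> i else 0)" for i j
  proof -
    have "j = \<sigma> i \<longleftrightarrow> index_pos j = partner (index_pos i)"
      by (metis \<sigma> injD inj_index_pos)
    moreover have "?J $ i $ j =
        (if index_pos j = partner (index_pos i) then \<epsilon> i else 0)"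
      unfolding block_rot_def partner_def \<epsilon>_def
      by (cases "even (index_pos i)") (auto elim!: oddE)
    ultimately show ?thesis
      by simp
  qed
  \<comment> \<open>The rows are orthonormal; for a square matrix this right inverse is also a left
    inverse.\<close>
  have "?J ** transpose ?J = mat 1"
  proof -
    have "(\<Sum>k\<in>UNIV. ?J $ i $ k * ?J $ j $ k) = (if i = j then 1 else 0)" for i j
    proof -
      have "(\<Sum>k\<in>UNIV. ?J $ i $ k * ?J $ j $ k)
          = (\<Sum>k\<in>UNIV. if k = \<sigma> i then \<epsilon> i * ?J $ j $ \<sigma> i else 0)"
        by (rule sum.cong) (auto simp: entry)
      also have "\<dots> = \<epsilon> i * ?J $ j $ \<sigma> i" by simp
      also have "\<dots> = (if i = j then 1 else 0)" by (auto simp: entry \<sigma>_inj \<epsilon>_def)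
      finally show ?thesis .
    qed
    then show ?thesis
      by (simp add: vec_eq_iff matrix_matrix_mult_def transpose_def mat_def)
  qed
  then show ?thesis by (simp add: matrix_left_right_inverse)
qed

section \<open>Pairs that attain the great-circle bound, and the value of the minimum\<close>

theorem theorem5p5:
  fixes \<beta> :: real
  assumes "CARD('p::{finite,linorder}) \<le> CARD('n::finite)"
    and "even CARD('p)"
    and "0 < \<beta>" and "\<beta> \<le> 1"
  shows "(\<forall>\<delta>\<in>{0..2 * sqrt (real CARD('p))}. \<exists>\<theta>::real.
            \<forall>U\<in>(stiefel :: (real^'p::{finite,linorder}^'n) set). \<forall>Q :: real^'p::{finite,linorder}^'p::{finite,linorder}. orthogonal_matrix Q \<longrightarrow>
              beta_dist \<beta> U (U ** Q ** block_rot \<theta> ** transpose Q)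
                = ereal (2 * sqrt (\<beta> * real CARD('p)) * arcsin (\<delta> / (2 * sqrt (real CARD('p))))) \<and>
              norm (U - U ** Q ** block_rot \<theta> ** transpose Q) = \<delta>)
       \<and> (\<forall>\<delta>\<in>{0..2 * sqrt (real CARD('p))}.
            m_beta TYPE('n) TYPE('p) \<beta> \<delta> \<in> dists_at TYPE('n) TYPE('p) \<beta> \<delta> \<and>
            ereal (m_hat CARD('p) \<beta> \<delta>) = m_beta TYPE('n) TYPE('p) \<beta> \<delta>)"
proof -
  let ?p = "real CARD('p)"
  let ?J = "block_rot (pi / 2) :: real^'p::{finite,linorder}^'p::{finite,linorder}"
  \<comment> \<open>Chosen so that the chord \<open>2 * sqrt ?p * sin (ang \<delta> / 2)\<close>
    equals \<open>\<delta>\<close>.\<close>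
  define ang where "ang \<delta> = 2 * arcsin (\<delta> / (2 * sqrt ?p))" for \<delta>
  have p: "0 < ?p" by simp
  have ang: "0 \<le> ang \<delta>" "ang \<delta> \<le> pi" "2 * sqrt ?p * sin (ang \<delta> / 2) = \<delta>"
    if "\<delta> \<in> {0..2 * sqrt ?p}" for \<delta>
  proof -
    have "0 \<le> \<delta> / (2 * sqrt ?p)" "\<delta> / (2 * sqrt ?p) \<le> 1"
      using that p by (auto simp: divide_le_eq)
    then have "0 \<le> arcsin (\<delta> / (2 * sqrt ?p))" "arcsin (\<delta> / (2 * sqrt ?p)) \<le> pi / 2"
      "sin (arcsin (\<delta> / (2 * sqrt ?p))) = \<delta> / (2 * sqrt ?p)"
      using arcsin_bounded [of "\<delta> / (2 * sqrt ?p)"] arcsin_le_arcsin [of 0 "\<delta> / (2 * sqrt ?p)"] by auto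
    then show "0 \<le> ang \<delta>" "ang \<delta> \<le> pi" "2 * sqrt ?p * sin (ang \<delta> / 2) = \<delta>"
      by (simp_all add: ang_def)
  qed
  have main: "beta_dist \<beta> U V = ereal (2 * sqrt (\<beta> * ?p) * arcsin (\<delta> / (2 * sqrt ?p)))"
    "norm (U - V) = \<delta>" "V \<in> stiefel" "connected_component stiefel U V"
    if \<delta>: "\<delta> \<in> {0..2 * sqrt ?p}" and U: "U \<in> stiefel" and Q: "orthogonal_matrix Q"
      and V: "V = U ** Q ** block_rot (ang \<delta>) ** transpose Q"
    for \<delta> and U V :: "real^'p::{finite,linorder}^'n" and Q
  proof -
    \<comment> \<open>Conjugation by \<open>Q\<close> preserves skew-symmetry and orthogonality and
      fixes \<open>mat 1\<close>, so \<open>V\<close> is the point at angle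
      \<open>ang \<delta>\<close> on the great circle through \<open>U\<close> generated by
      \<open>K\<close>.\<close>
    define K where "K = Q ** ?J ** transpose Q"
    have QQ: "Q ** transpose Q = mat 1" "transpose Q ** Q = mat 1"
      using Q by (auto simp: orthogonal_matrix_def)
    have "transpose K ** K = Q ** (transpose ?J ** (transpose Q ** Q) ** ?J) ** transpose Q"
      by (simp add: K_def matrix_transpose_mul matrix_mul_assoc)
    also have "\<dots> = mat 1"
      by (simp add: QQ block_rot_right_angle_orthogonal assms(2))
    finally have orth: "transpose K ** K = mat 1" .
    have skew: "transpose K = - K"
      by (simp add: K_def matrix_transpose_mul transpose_block_rot_right_angle
          matrix_uminus_left matrix_uminus_right matrix_mul_assoc)
    have "V = U ** (Q ** block_rot (ang \<delta>) ** transpose Q)"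
      by (simp add: V matrix_mul_assoc)
    also have "Q ** block_rot (ang \<delta>) ** transpose Q
        = cos (ang \<delta>) *\<^sub>R mat 1 + sin (ang \<delta>) *\<^sub>R K"
      unfolding block_rot_decompose [of "ang \<delta>"]
      by (simp add: K_def matrix_add_ldistrib matrix_add_rdistrib scaleR_matrix_mult QQ)
    finally have V': "V = U ** (cos (ang \<delta>) *\<^sub>R mat 1 + sin (ang \<delta>) *\<^sub>R K)" .
    note gc = great_circle_norm_dist [OF orth skew U ang(1,2) [OF \<delta>] assms(3,4), folded V']
    show "beta_dist \<beta> U V = ereal (2 * sqrt (\<beta> * ?p) * arcsin (\<delta> / (2 * sqrt ?p)))"
      using gc(2) by (simp add: ang_def)
    show "norm (U - V) = \<delta>" "V \<in> stiefel" "connected_component stiefel U V"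
      using gc ang(3) [OF \<delta>] by simp_all
  qed
  have m: "m_beta TYPE('n) TYPE('p) \<beta> \<delta> \<in> dists_at TYPE('n) TYPE('p) \<beta> \<delta>
      \<and> ereal (m_hat CARD('p) \<beta> \<delta>) = m_beta TYPE('n) TYPE('p) \<beta> \<delta>"
    if \<delta>: "\<delta> \<in> {0..2 * sqrt ?p}" for \<delta>
  proof -
    have hat: "m_hat CARD('p) \<beta> \<delta> = 2 * sqrt (\<beta> * ?p) * arcsin (\<delta> / (2 * sqrt ?p))"
      using assms(4) by (simp add: m_hat_def real_sqrt_mult min_absorb2)
    obtain U :: "real^'p::{finite,linorder}^'n" where U: "U \<in> stiefel"
      using stiefel_nonempty [where 'p='p and 'n='n] assms(1) by auto
    \<comment> \<open>One pair suffices for attainment, so \<open>Q\<close> is taken to be the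
      identity; \<open>beta_dist_ge\<close> then shows that no other pair at chord length
      \<open>\<delta>\<close> is closer.\<close>
    have "orthogonal_matrix (mat 1 :: real^'p::{finite,linorder}^'p::{finite,linorder})"
      by (rule orthogonal_matrix_id)
    from main [OF \<delta> U this refl] U
    have mem: "ereal (m_hat CARD('p) \<beta> \<delta>) \<in> dists_at TYPE('n) TYPE('p) \<beta> \<delta>"
      unfolding dists_at_def hat by (smt (verit, best) mem_Collect_eq norm_minus_commute)
    moreover have "ereal (m_hat CARD('p) \<beta> \<delta>) \<le> x" if "x \<in> dists_at TYPE('n) TYPE('p) \<beta> \<delta>" for x
      using that beta_dist_ge [OF assms(3,4)] unfolding dists_at_def hat by blast
    ultimately have "m_beta TYPE('n) TYPE('p) \<beta> \<delta> = ereal (m_hat CARD('p) \<beta> \<delta>)"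
      unfolding m_beta_def by (intro Inf_eqI) auto
    with mem show ?thesis by simp
  qed
  show ?thesis
  proof (intro conjI ballI)
    fix \<delta> assume \<delta>: "\<delta> \<in> {0..2 * sqrt ?p}"
    show "\<exists>\<theta>. \<forall>U\<in>(stiefel :: (real^'p::{finite,linorder}^'n) set). \<forall>Q. orthogonal_matrix Q \<longrightarrow>
        beta_dist \<beta> U (U ** Q ** block_rot \<theta> ** transpose Q)
          = ereal (2 * sqrt (\<beta> * ?p) * arcsin (\<delta> / (2 * sqrt ?p))) \<and>
        norm (U - U ** Q ** block_rot \<theta> ** transpose Q) = \<delta>"
      using main(1,2) [OF \<delta> _ _ refl] by blast
  qed (use m in auto)
qed

end
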